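(* Let $\mathcal{E}$ be an ellipse with center $O$ and semi-axes $a,b>0$. The signed area $A_c$ of the contrapedal curve $\mathcal{E}_c$ of $\mathcal{E}$ with respect to a point $M$ is constant as $M$ ranges over any circle centered at $O$ (concentric with $\mathcal{E}$).
   Context: Parametrize $\mathcal{E}$ by $P(t)=(a\cos t,b\sin t)$, $t\in[0,2\pi]$, with center $O=(0,0)$. The contrapedal curve $\mathcal{E}_c$ with respect to $M$ is $t\mapsto Q_c(t)$, where $Q_c(t)$ is the foot of the perpendicular dropped from $M$ onto the normal line to $\mathcal{E}$ at $P(t)$. The signed area of a closed parametrized curve $\gamma$ is $\frac12\int_\gamma(x\,dy-y\,dx)$, with orientation given by increasing $t$. *)

theory Defs
  imports "HOL-Analysis.Analysis"
begin

definition ellipse_param :: "real \<Rightarrow> real \<Rightarrow> real \<Rightarrow> real^2" where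
  "ellipse_param a b t = vector [a * cos t, b * sin t]"

text \<open>This set is a line only where the velocity of the curve exists and is nonzero, which is
  the case at every parameter of an ellipse with positive semi-axes.\<close>
definition normal_line :: "(real \<Rightarrow> real^2) \<Rightarrow> real \<Rightarrow> (real^2) set" where
  "normal_line \<gamma> t = {X. orthogonal (X - \<gamma> t) (vector_derivative \<gamma> (at t))}"

definition foot_of_perpendicular :: "real^2 \<Rightarrow> (real^2) set \<Rightarrow> real^2" where
  "foot_of_perpendicular M L =
     (THE Q. Q \<in> L \<and> (\<forall>X\<in>L. \<forall>Y\<in>L. orthogonal (Q - M) (X - Y)))"

definition contrapedal :: "(real \<Rightarrow> real^2) \<Rightarrow> real^2 \<Rightarrow> real \<Rightarrow> real^2" where
  "contrapedal \<gamma> M t = foot_of_perpendicular M (normal_line \<gamma> t)"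

text \<open>Derivatives are taken within the parameter interval, so the value depends only on
  the curve restricted to it.\<close>
definition signed_area :: "real \<Rightarrow> real \<Rightarrow> (real \<Rightarrow> real^2) \<Rightarrow> real" where
  "signed_area p q \<gamma> =
     1 / 2 * integral {p..q} (\<lambda>t.
       let \<gamma>' = vector_derivative \<gamma> (at t within {p..q})
       in \<gamma> t $ 1 * \<gamma>' $ 2 - \<gamma> t $ 2 * \<gamma>' $ 1)"

text \<open>The definite description above denotes as intended on every line.\<close>
lemma foot_of_perpendicular_line:
  fixes M P v :: "real^2"
  assumes "v \<noteq> 0"
  shows "foot_of_perpendicular M {X. orthogonal (X - P) v} =
           M - (((M - P) \<bullet> v) / (v \<bullet> v)) *\<^sub>R v"
proof -
  let ?L = "{X. orthogonal (X - P) v}"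
  let ?Q = "M - (((M - P) \<bullet> v) / (v \<bullet> v)) *\<^sub>R v"
  have Q: "?Q \<in> ?L"
    using assms by (simp add: orthogonal_def inner_diff_left)
  have perp: "\<forall>X\<in>?L. \<forall>Y\<in>?L. orthogonal (?Q - M) (X - Y)"
    by (auto simp: orthogonal_def inner_diff_left inner_diff_right inner_commute)
  show ?thesis
    unfolding foot_of_perpendicular_def
  proof (rule the_equality)
    show "?Q \<in> ?L \<and> (\<forall>X\<in>?L. \<forall>Y\<in>?L. orthogonal (?Q - M) (X - Y))"
      using Q perp by blast
  next
    fix R assume R: "R \<in> ?L \<and> (\<forall>X\<in>?L. \<forall>Y\<in>?L. orthogonal (R - M) (X - Y))"
    then have "(R - M) \<bullet> (R - ?Q) = 0" "(?Q - M) \<bullet> (R - ?Q) = 0"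
      using Q perp unfolding orthogonal_def by blast+
    then have "((R - M) - (?Q - M)) \<bullet> (R - ?Q) = 0"
      by (simp only: inner_diff_left) 
    then have "(R - ?Q) \<bullet> (R - ?Q) = 0" by (simp only: diff_diff_eq2 diff_add_cancel)
    then show "R = ?Q" by (simp only: inner_eq_zero_iff right_minus_eq)
  qed
qed

end

theory Submission
  imports Defs
begin

text \<open>Let \<open>v\<close> be the velocity of the ellipse and \<open>w = v \<bullet> v\<close>. The foot of the perpendicular is
  \<open>Q = M - k v\<close> with \<open>k = ((M - P) \<bullet> v) / w\<close>. Up to the derivative of the \<open>2\<pi>\<close>-periodic
  function \<open>M \<times> Q\<close>, the area integrand \<open>Q \<times> Q'\<close> is \<open>k\<^sup>2 (v \<times> v') = a b k\<^sup>2\<close>, so \<open>2 A\<^sub>c\<close> is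
  \<open>a b\<close> times the integral of \<open>k\<^sup>2\<close>.

  For \<open>M = (x, y)\<close> one has \<open>k = (\<ell> + d sin t cos t) / w\<close>, where \<open>\<ell> = b y cos t - a x sin t\<close> and
  \<open>d = a\<^sup>2 - b\<^sup>2\<close>. In the square of \<open>k\<close>:
  \<^item> the cross term changes sign under \<open>t \<mapsto> t + \<pi>\<close>, since \<open>\<ell>\<close> does while \<open>sin t cos t\<close> and \<open>w\<close>
    do not, so its integral vanishes (\<open>integral_antiperiodic\<close>);
  \<^item> \<open>(d sin t cos t / w)\<^sup>2\<close> does not involve \<open>M\<close>;
  \<^item> \<open>\<ell>\<^sup>2 / w\<^sup>2\<close> equals \<open>(x\<^sup>2 + y\<^sup>2) / (2 w)\<close> up to a combination of
    \<open>(b\<^sup>2 cos\<^sup>2 t - a\<^sup>2 sin\<^sup>2 t) / w\<^sup>2\<close> and \<open>sin t cos t / w\<^sup>2\<close>, which are derivatives of the periodic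
    functions \<open>sin t cos t / w\<close> and \<open>- cos\<^sup>2 t / (2 a\<^sup>2 w)\<close>.

  Hence the area depends on \<open>M\<close> through \<open>x\<^sup>2 + y\<^sup>2\<close> alone (\<open>signed_area_contrapedal_ellipse\<close>).\<close>

lemma has_vector_derivative_vector2:
  fixes f g :: "real \<Rightarrow> real"
  assumes "(f has_real_derivative f') (at t within S)"
    and "(g has_real_derivative g') (at t within S)"
  shows "((\<lambda>t. vector [f t, g t] :: real^2) has_vector_derivative vector [f', g']) (at t within S)"
proof -
  have split: "(vector [p, q] :: real^2) = p *\<^sub>R axis 1 1 + q *\<^sub>R axis 2 1" for p q :: real
    by (simp add: vec_eq_iff forall_2 axis_def)
  show ?thesis
    unfolding split using assms
    by (auto intro!: derivative_eq_intros simp: has_real_derivative_iff_has_vector_derivative)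
qed

lemma signed_area_vector2:
  fixes f g :: "real \<Rightarrow> real"
  assumes "p < q"
    and "\<And>t. (f has_real_derivative f' t) (at t)"
    and "\<And>t. (g has_real_derivative g' t) (at t)"
  shows "signed_area p q (\<lambda>t. vector [f t, g t]) =
           1 / 2 * integral {p..q} (\<lambda>t. f t * g' t - g t * f' t)"
proof -
  have "vector_derivative (\<lambda>t. vector [f t, g t] :: real^2) (at t within {p..q}) = vector [f' t, g' t]"
    if "t \<in> {p..q}" for t
    using has_vector_derivative_vector2[OF assms(2,3)] assms(1) that
    by (intro vector_derivative_within_closed_interval)
       (auto intro: has_vector_derivative_at_within)
  then show ?thesis
    unfolding signed_area_def by (intro arg_cong[where f = "\<lambda>x. 1 / 2 * x"] integral_cong) simp
qed

text \<open>The second half of the interval contributes the opposite of the first.\<close>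
lemma integral_antiperiodic:
  fixes f :: "real \<Rightarrow> real"
  assumes "continuous_on UNIV f" and "p \<ge> 0" and "\<And>t. f (t + p) = - f t"
  shows "integral {0..2 * p} f = 0"
proof -
  have int: "f integrable_on {u..v}" for u v
    using assms(1) by (intro integrable_continuous_real) (rule continuous_on_subset, auto)
  have "integral {p..2 * p} f = integral {0..p} (\<lambda>t. f (t + p))"
    using integral_shift_real_ivl[of p p "2 * p" f] by simp
  also have "\<dots> = - integral {0..p} f"
    by (simp add: assms(3))
  finally show ?thesis
    using Henstock_Kurzweil_Integration.integral_combine[of 0 p "2 * p" f] assms(2) int by simp
qed

definition speed_sq :: "real \<Rightarrow> real \<Rightarrow> real \<Rightarrow> real" where
  "speed_sq a b t = (a * sin t)\<^sup>2 + (b * cos t)\<^sup>2"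

text \<open>The number \<open>k\<close> with \<open>M - Q = k v\<close>, for \<open>M = (x, y)\<close> and \<open>Q\<close> its foot on the normal at \<open>t\<close>;
  the term with \<open>a\<^sup>2 - b\<^sup>2\<close> is \<open>- P \<bullet> v\<close>.\<close>
definition tangential_coord :: "real \<Rightarrow> real \<Rightarrow> real \<Rightarrow> real \<Rightarrow> real \<Rightarrow> real" where
  "tangential_coord a b x y t =
     (b * y * cos t - a * x * sin t + (a\<^sup>2 - b\<^sup>2) * (sin t * cos t)) / speed_sq a b t"

lemma speed_sq_pos:
  assumes "a > 0" "b > 0"
  shows "speed_sq a b t > 0"
proof (cases "cos t = 0")
  case True
  then have "sin t \<noteq> 0" using sin_zero_abs_cos_one by force
  then show ?thesis using assms by (simp add: speed_sq_def True)
next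
  case False
  then show ?thesis using assms by (simp add: speed_sq_def add_nonneg_pos)
qed

lemma DERIV_speed_sq:
  "(speed_sq a b has_real_derivative 2 * (a\<^sup>2 - b\<^sup>2) * (sin t * cos t)) (at t)"
  unfolding speed_sq_def[abs_def]
  by (auto intro!: derivative_eq_intros simp: power2_eq_square algebra_simps)

lemma continuous_on_speed_sq: "continuous_on S (speed_sq a b)"
  unfolding speed_sq_def[abs_def] by (intro continuous_intros)

lemma DERIV_tangential_coord:
  assumes "a > 0" "b > 0"
  shows "\<exists>k'. \<forall>t. (tangential_coord a b x y has_real_derivative k' t) (at t)"
proof -
  have "\<exists>D. (tangential_coord a b x y has_real_derivative D) (at t)" for t
    unfolding tangential_coord_def[abs_def]
    using speed_sq_pos[OF assms, of t]
    by (intro exI) (rule derivative_eq_intros DERIV_speed_sq refl | simp)+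
  then show ?thesis by metis
qed

lemma contrapedal_ellipse:
  assumes "a > 0" "b > 0"
  shows "contrapedal (ellipse_param a b) M t =
           vector [M $ 1 + a * tangential_coord a b (M $ 1) (M $ 2) t * sin t,
                   M $ 2 - b * tangential_coord a b (M $ 1) (M $ 2) t * cos t]"
proof -
  let ?v = "vector [- a * sin t, b * cos t] :: real^2"
  have "(ellipse_param a b has_vector_derivative ?v) (at t)"
    unfolding ellipse_param_def[abs_def]
    by (rule has_vector_derivative_vector2) (auto intro!: derivative_eq_intros)
  then have vel: "vector_derivative (ellipse_param a b) (at t) = ?v"
    by (rule vector_derivative_at)
  have vv: "?v \<bullet> ?v = speed_sq a b t"
    by (simp add: inner_vec_def sum_2 speed_sq_def power2_eq_square)
  then have "?v \<noteq> 0"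
    using speed_sq_pos[OF assms, of t] by force
  moreover have "(M - ellipse_param a b t) \<bullet> ?v / (?v \<bullet> ?v) =
      tangential_coord a b (M $ 1) (M $ 2) t"
    unfolding vv tangential_coord_def ellipse_param_def
    by (simp add: inner_vec_def sum_2 power2_eq_square algebra_simps)
  ultimately show ?thesis
    unfolding contrapedal_def normal_line_def vel
    by (simp add: foot_of_perpendicular_line vec_eq_iff forall_2)
qed

text \<open>Periodicity of these antiderivatives is what makes the two corresponding integrals over a
  full period vanish. The derivative of \<open>1 / w\<close> is also a multiple of \<open>sin t cos t / w\<^sup>2\<close>, but it
  is zero for the circle \<open>a = b\<close>; that of \<open>cos\<^sup>2 t / w\<close> serves all cases.\<close>
lemma
  assumes "a > 0" "b > 0"
  shows DERIV_sin_cos_over_speed_sq: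
      "((\<lambda>t. sin t * cos t / speed_sq a b t) has_real_derivative
         ((b * cos t)\<^sup>2 - (a * sin t)\<^sup>2) / (speed_sq a b t)\<^sup>2) (at t)" (is ?A)
    and DERIV_cos_sq_over_speed_sq:
      "((\<lambda>t. (cos t)\<^sup>2 / speed_sq a b t) has_real_derivative
         - 2 * a\<^sup>2 * (sin t * cos t) / (speed_sq a b t)\<^sup>2) (at t)" (is ?B)
proof -
  have w: "speed_sq a b t \<noteq> 0" using speed_sq_pos[OF assms, of t] by simp
  have one: "(sin t)\<^sup>2 = 1 - (cos t)\<^sup>2" by (simp add: sin_squared_eq)
  have 1: "(cos t * cos t - sin t * sin t) * speed_sq a b t
       - sin t * cos t * (2 * (a\<^sup>2 - b\<^sup>2) * (sin t * cos t)) = (b * cos t)\<^sup>2 - (a * sin t)\<^sup>2"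
    unfolding speed_sq_def using one by algebra
  have 2: "- (2 * cos t * sin t) * speed_sq a b t
       - (cos t)\<^sup>2 * (2 * (a\<^sup>2 - b\<^sup>2) * (sin t * cos t)) = - 2 * a\<^sup>2 * (sin t * cos t)"
    unfolding speed_sq_def using one by algebra
  show ?A
    unfolding 1[symmetric]
    using w by (auto intro!: derivative_eq_intros DERIV_speed_sq
      simp: power2_eq_square algebra_simps)
  show ?B
    unfolding 2[symmetric]
    using w by (auto intro!: derivative_eq_intros DERIV_speed_sq
      simp: power2_eq_square algebra_simps)
qed

lemma signed_area_contrapedal_ellipse:
  assumes "a > 0" "b > 0"
  shows "signed_area 0 (2 * pi) (contrapedal (ellipse_param a b) M) =
    1 / 2 * integral {0..2 * pi} (\<lambda>t. a * b * ((norm M)\<^sup>2 / (2 * speed_sq a b t) +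
      ((a\<^sup>2 - b\<^sup>2) * (sin t * cos t) / speed_sq a b t)\<^sup>2))"
proof -
  define x where "x = M $ 1"
  define y where "y = M $ 2"
  define w where "w = speed_sq a b"
  define k where "k = tangential_coord a b x y"
  define d where "d = a\<^sup>2 - b\<^sup>2"
  define l where "l t = b * y * cos t - a * x * sin t" for t
  note w_cont = continuous_on_speed_sq[of _ a b, folded w_def]
  have w0: "w t \<noteq> 0" for t using speed_sq_pos[OF assms, of t] by (simp add: w_def)
  obtain k' where k': "\<And>t. (k has_real_derivative k' t) (at t)"
    using DERIV_tangential_coord[OF assms] unfolding k_def by metis
  have norm_M: "(norm M)\<^sup>2 = x\<^sup>2 + y\<^sup>2"
    unfolding power2_norm_eq_inner
    by (simp add: x_def y_def inner_vec_def sum_2 power2_eq_square)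
  define main where "main t = a * b * ((norm M)\<^sup>2 / (2 * w t) + (d * (sin t * cos t) / w t)\<^sup>2)" for t
  define cross where "cross t = 2 * a * b * d * (l t * (sin t * cos t)) / (w t)\<^sup>2" for t
  \<comment> \<open>The first summand is \<open>M \<times> Q\<close>, the other two absorb the part of \<open>a b \<ell>\<^sup>2 / w\<^sup>2\<close> that is not
    a multiple of \<open>x\<^sup>2 + y\<^sup>2\<close>.\<close>
  define G where "G t = - k t * (b * x * cos t + a * y * sin t) +
    (a * b * (y\<^sup>2 - x\<^sup>2) / 2 * (sin t * cos t / w t) + b\<^sup>2 * x * y * ((cos t)\<^sup>2 / w t))" for t
  define G' where "G' t = (- k' t * (b * x * cos t + a * y * sin t) +
      k t * (b * x * sin t - a * y * cos t)) +
    (a * b * (y\<^sup>2 - x\<^sup>2) / 2 * (((b * cos t)\<^sup>2 - (a * sin t)\<^sup>2) / (w t)\<^sup>2) +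
     b\<^sup>2 * x * y * (- 2 * a\<^sup>2 * (sin t * cos t) / (w t)\<^sup>2))" for t
  have area: "signed_area 0 (2 * pi) (contrapedal (ellipse_param a b) M) =
    1 / 2 * integral {0..2 * pi} (\<lambda>t.
      (x + a * k t * sin t) * (b * k t * sin t - b * k' t * cos t) -
      (y - b * k t * cos t) * (a * k' t * sin t + a * k t * cos t))"
    unfolding contrapedal_ellipse[OF assms, abs_def] x_def[symmetric] y_def[symmetric] k_def[symmetric]
    by (rule signed_area_vector2) (auto intro!: derivative_eq_intros k' simp: algebra_simps)
  have integrand: "(x + a * k t * sin t) * (b * k t * sin t - b * k' t * cos t) -
      (y - b * k t * cos t) * (a * k' t * sin t + a * k t * cos t) = main t + G' t + cross t" for t
  proof -
    have one: "(sin t)\<^sup>2 + (cos t)\<^sup>2 = 1" by simp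
    have wt: "w t = (a * sin t)\<^sup>2 + (b * cos t)\<^sup>2" by (simp add: w_def speed_sq_def)
    have kt: "k t = (l t + d * (sin t * cos t)) / w t"
      by (simp add: k_def tangential_coord_def l_def d_def w_def)
    \<comment> \<open>With \<open>Q = M - k v\<close>, the terms in \<open>k k'\<close> cancel since \<open>v \<times> v = 0\<close>.\<close>
    have "(x + a * k t * sin t) * (b * k t * sin t - b * k' t * cos t) -
        (y - b * k t * cos t) * (a * k' t * sin t + a * k t * cos t) =
        a * b * (k t)\<^sup>2 + (- k' t * (b * x * cos t + a * y * sin t) +
          k t * (b * x * sin t - a * y * cos t))"
      using one by algebra
    moreover have "a * b * (k t)\<^sup>2 = a * b * (l t)\<^sup>2 / (w t)\<^sup>2 +
        a * b * (d * (sin t * cos t) / w t)\<^sup>2 + cross t"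
      unfolding kt cross_def by (simp add: power2_eq_square add_divide_distrib algebra_simps)
    moreover have "a * b * (l t)\<^sup>2 / (w t)\<^sup>2 = a * b * ((x\<^sup>2 + y\<^sup>2) / (2 * w t)) +
        (a * b * (y\<^sup>2 - x\<^sup>2) / 2 * (((b * cos t)\<^sup>2 - (a * sin t)\<^sup>2) / (w t)\<^sup>2) +
         b\<^sup>2 * x * y * (- 2 * a\<^sup>2 * (sin t * cos t) / (w t)\<^sup>2))"
    proof -
      have "2 * (l t)\<^sup>2 = (x\<^sup>2 + y\<^sup>2) * w t + (y\<^sup>2 - x\<^sup>2) * ((b * cos t)\<^sup>2 - (a * sin t)\<^sup>2)
          - 4 * a * b * x * y * (sin t * cos t)"
        unfolding l_def wt by algebra
      \<comment> \<open>Fresh letters keep the trigonometric terms atomic, so that clearing denominators leaves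
        a polynomial identity.\<close>
      moreover have "a * b * L / W\<^sup>2 = a * b * (N / (2 * W)) + (a * b * E / 2 * (D / W\<^sup>2) +
          b\<^sup>2 * x * y * (- 2 * a\<^sup>2 * S / W\<^sup>2))"
        if "2 * L = N * W + E * D - 4 * a * b * x * y * S" "W \<noteq> 0" for L N W E D S :: real
        using that(2) by (simp add: field_simps power2_eq_square) (use that(1) in algebra)
      ultimately show ?thesis using w0 by blast
    qed
    ultimately show ?thesis
      by (simp add: main_def G'_def norm_M algebra_simps)
  qed
  have main_int: "(main has_integral integral {0..2 * pi} main) {0..2 * pi}"
    unfolding main_def[abs_def]
    by (intro integrable_integral integrable_continuous_real continuous_intros w_cont) (auto simp: w0)
  have G_int: "(G' has_integral G (2 * pi) - G 0) {0..2 * pi}"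
  proof (rule fundamental_theorem_of_calculus)
    fix t :: real
    have "(G has_real_derivative G' t) (at t)"
      unfolding G_def[abs_def] G'_def
      by (intro DERIV_add DERIV_cmult DERIV_sin_cos_over_speed_sq[OF assms, folded w_def]
          DERIV_cos_sq_over_speed_sq[OF assms, folded w_def])
         (auto intro!: derivative_eq_intros k' simp: algebra_simps)
    then show "(G has_vector_derivative G' t) (at t within {0..2 * pi})"
      by (simp add: has_real_derivative_iff_has_vector_derivative has_vector_derivative_at_within)
  qed simp
  have G_periodic: "G (2 * pi) - G 0 = 0"
    by (simp add: G_def k_def w_def tangential_coord_def speed_sq_def)
  have cross_int: "(cross has_integral 0) {0..2 * pi}"
  proof -
    have cont: "continuous_on S cross" for S
      unfolding cross_def[abs_def] l_def by (intro continuous_intros w_cont) (auto simp: w0)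
    have "l (t + pi) = - l t" "w (t + pi) = w t" for t
      by (simp_all add: l_def w_def speed_sq_def)
    then have "integral {0..2 * pi} cross = 0"
      by (intro integral_antiperiodic[OF cont]) (simp_all add: cross_def)
    then show ?thesis
      using integrable_integral[OF integrable_continuous_real[OF cont]] by metis
  qed
  have "((\<lambda>t. main t + G' t + cross t) has_integral integral {0..2 * pi} main) {0..2 * pi}"
    using has_integral_add[OF has_integral_add[OF main_int G_int] cross_int]
    unfolding G_periodic by simp
  then show ?thesis
    unfolding area integrand d_def[symmetric] w_def[symmetric] main_def[symmetric]
    by (simp only: integral_unique)
qed

theorem corollary2:
  fixes a b r :: real
  assumes "a > 0" and "b > 0" and "r > 0"
  shows "(\<lambda>M. signed_area 0 (2 * pi) (contrapedal (ellipse_param a b) M))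
           constant_on sphere 0 r"
  unfolding constant_on_def signed_area_contrapedal_ellipse[OF assms(1,2)]
  by (intro exI ballI) (simp only: mem_sphere_0)

end
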